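(* Let $2<p<\infty$ and $n\in\mathbb{N}$. Suppose that $f\in H^p$ has inner part $J$, with $J(0)\ne0$. Let $w_1,\dots,w_k$ be the roots (counting multiplicities) of $q_{n,p}[f]$ in $\mathbb{D}$. Then $$|w_1\cdots w_k|\ge\frac1{|J(0)|}\left(1-\left(\frac{(p-1)\|f-f(0)\|_p^2}{|f(0)|^2+(p-1)\|f-f(0)\|_p^2}\right)^{p/2}\right)^{1/2}.$$
   Context: $\mathbb{N}=\{0,1,2,\dots\}$ and $\mathbb{D}$ is the open unit disk. $H^p$ is the Hardy space of analytic functions on $\mathbb{D}$ with norm $\|f\|_p^p=\sup_{0<r<1}\frac1{2\pi}\int_0^{2\pi}|f(re^{i\theta})|^p\,d\theta$. Every nonzero $f\in H^p$ factors as $f=JF$ with $J$ inner (bounded analytic with boundary values of modulus $1$ a.e.) and $F$ outer; $J$ is its inner part, unique up to a unimodular constant. $\mathcal{P}_n$ is the set of complex polynomials of degree at most $n$. For $f\in H^p$ with $f(0)\ne0$, the $n$-th optimal polynomial approximant $q_{n,p}[f]$ to $1/f$ in $H^p$ is the unique element of $\mathcal{P}_n$ with $\|1-q_{n,p}[f]f\|_p=\inf_{q\in\mathcal{P}_n}\|1-qf\|_p$. An empty product (no roots in $\mathbb{D}$) equals $1$. *)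

theory Defs
  imports "HOL-Complex_Analysis.Complex_Analysis" "HOL-Computational_Algebra.Computational_Algebra"
begin

(* Functions on the unit disk are total functions complex => complex of which only the values
   on ball 0 1 are used; two of them are identified when they agree there. *)

definition circle_mean :: "real \<Rightarrow> (complex \<Rightarrow> complex) \<Rightarrow> real \<Rightarrow> real" where
  "circle_mean p f r =
     1 / (2 * pi) * integral {0..2 * pi} (\<lambda>t. norm (f (of_real r * cis t)) powr p)"

definition Hardy :: "real \<Rightarrow> (complex \<Rightarrow> complex) set" where
  "Hardy p = {f. f holomorphic_on ball 0 1 \<and> bdd_above (circle_mean p f ` {0<..<1})}"

(* The supremum is a real one, so this is meaningful only for f in Hardy p. *)
definition Hardy_norm :: "real \<Rightarrow> (complex \<Rightarrow> complex) \<Rightarrow> real" where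
  "Hardy_norm p f = (SUP r\<in>{0<..<1}. circle_mean p f r) powr (1 / p)"

(* Boundary values are radial limits. *)
definition inner_function :: "(complex \<Rightarrow> complex) \<Rightarrow> bool" where
  "inner_function J \<longleftrightarrow> J holomorphic_on ball 0 1 \<and> bounded (J ` ball 0 1) \<and>
     (AE t in lebesgue. \<exists>b. ((\<lambda>r. J (of_real r * cis t)) \<longlongrightarrow> b) (at_left 1) \<and> norm b = 1)"

(* F z = c exp (1/(2 pi) \<integral> (e^{it} + z) / (e^{it} - z) log \<phi>(t) dt) with |c| = 1, where \<phi> > 0 is the
   prescribed boundary modulus and log \<phi> is Lebesgue integrable. *)
definition outer_function :: "(complex \<Rightarrow> complex) \<Rightarrow> bool" where
  "outer_function F \<longleftrightarrow> (\<exists>c \<phi>. norm c = 1 \<and> (\<forall>t\<in>{0..2 * pi}. 0 < \<phi> t) \<and>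
     (\<lambda>t. ln (\<phi> t)) absolutely_integrable_on {0..2 * pi} \<and>
     (\<forall>z\<in>ball 0 1. F z = c * exp (1 / (2 * of_real pi) *
        integral {0..2 * pi} (\<lambda>t. (cis t + z) / (cis t - z) * of_real (ln (\<phi> t))))))"

(* A relation, since the inner part is determined only up to a unimodular constant. *)
definition inner_part :: "real \<Rightarrow> (complex \<Rightarrow> complex) \<Rightarrow> (complex \<Rightarrow> complex) \<Rightarrow> bool" where
  "inner_part p f J \<longleftrightarrow> inner_function J \<and>
     (\<exists>F\<in>Hardy p. outer_function F \<and> (\<forall>z\<in>ball 0 1. f z = J z * F z))"

(* q is a best approximant; for f in Hardy p with f 0 \<noteq> 0 and 1 < p there is exactly one. *)
definition optimal_approximant ::
    "real \<Rightarrow> nat \<Rightarrow> (complex \<Rightarrow> complex) \<Rightarrow> complex poly \<Rightarrow> bool" where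
  "optimal_approximant p n f q \<longleftrightarrow> degree q \<le> n \<and>
     Hardy_norm p (\<lambda>z. 1 - poly q z * f z) =
       (INF r\<in>{r. degree r \<le> n}. Hardy_norm p (\<lambda>z. 1 - poly r z * f z))"

end

theory Submission
  imports Defs
begin

text \<open>
Write \<open>q f = I G\<close>, where \<open>I\<close> is \<open>J\<close> times the Blaschke product of the roots \<open>w\<^sub>1, \<dots>, w\<^sub>k\<close> of \<open>q\<close> in the
disc. Then \<open>I\<close> is inner, \<open>G\<close> lies in the Hardy space, and \<open>|I 0| = |J 0| |w\<^sub>1 \<dots> w\<^sub>k|\<close>. The theorem
compares two estimates of \<open>\<parallel>1 - q f\<parallel>\<close>.

From below, \<open>\<parallel>1 - I G\<parallel>\<^sup>p \<ge> 1 - |I 0|\<^sup>2\<close> for every \<open>G\<close> in the Hardy space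
(\<open>norm_inner_0_lower_bound\<close>). The extremal function is \<open>(1 - cnj (I 0) I)\<^bsup>2/p\<^esup>\<close>, and the tangent
inequality for \<open>|w|\<^sup>p\<close> at this function, integrated over a circle, shows that no other function of the
form \<open>1 - I G\<close> does better.

From above, \<open>\<parallel>1 - q f\<parallel>\<close> is at most \<open>\<parallel>1 - c f\<parallel>\<close> for every constant \<open>c\<close>, since \<open>q\<close> is optimal
(\<open>optimal_approximant_error\<close>). For \<open>p \<ge> 2\<close> the space \<open>L\<^sup>p\<close> is 2-uniformly smooth with constant \<open>p - 1\<close>,
and \<open>f - f 0\<close> has mean zero on circles, so
\<open>\<parallel>1 - c f\<parallel>\<^sup>2 \<le> |1 - c f 0|\<^sup>2 + (p - 1) |c|\<^sup>2 \<parallel>f - f 0\<parallel>\<^sup>2\<close> (\<open>mean_norm_powr_smooth\<close>). Minimising over \<open>c\<close> gives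
the fraction in the theorem.

Boundary values of Hardy functions are avoided by working on circles of radius \<open>r < 1\<close>. The boundary
values of inner functions enter through the convergence of their circle means to \<open>1\<close>
(\<open>inner_mean_tendsto\<close>).
\<close>

section \<open>Means over the angle and uniform smoothness\<close>

definition mean :: "(real \<Rightarrow> 'a::euclidean_space) \<Rightarrow> 'a" where
  "mean g = (1 / (2 * pi)) *\<^sub>R integral {0..2 * pi} g"

lemma circle_mean_eq_mean: "circle_mean p f r = mean (\<lambda>t. norm (f (of_real r * cis t)) powr p)"
  by (simp add: circle_mean_def mean_def)

lemma mean_const [simp]: "mean (\<lambda>t. c) = c"
  by (simp add: mean_def)

lemma mean_add:
  assumes "continuous_on {0..2 * pi} g" "continuous_on {0..2 * pi} h"
  shows "mean (\<lambda>t. g t + h t) = mean g + mean h"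
  using assms by (simp add: mean_def integral_add integrable_continuous_real scaleR_right_distrib)

lemma mean_linear:
  assumes "bounded_linear L" "continuous_on {0..2 * pi} g"
  shows "mean (\<lambda>t. L (g t)) = L (mean g)"
  using integral_linear[OF integrable_continuous_real[OF assms(2)] assms(1)] assms(1)
  by (simp add: mean_def o_def linear_simps)

lemma mean_cmult:
  fixes c :: "'a::{real_normed_algebra, euclidean_space}"
  assumes "continuous_on {0..2 * pi} g"
  shows "mean (\<lambda>t. c * g t) = c * mean g"
  by (rule mean_linear[OF bounded_linear_mult_right assms])

lemma mean_mono:
  fixes g h :: "real \<Rightarrow> real"
  assumes "continuous_on {0..2 * pi} g" "continuous_on {0..2 * pi} h"
    and "\<And>t. t \<in> {0..2 * pi} \<Longrightarrow> g t \<le> h t"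
  shows "mean g \<le> mean h"
  using assms
  by (auto simp: mean_def intro!: divide_right_mono integral_le integrable_continuous_real)

lemma mean_cong:
  assumes "\<And>t. t \<in> {0..2 * pi} \<Longrightarrow> g t = h t"
  shows "mean g = mean h"
  using assms by (auto simp: mean_def intro!: integral_cong)

lemma mean_nonneg:
  fixes g :: "real \<Rightarrow> real"
  assumes "continuous_on {0..2 * pi} g" "\<And>t. t \<in> {0..2 * pi} \<Longrightarrow> 0 \<le> g t"
  shows "0 \<le> mean g"
  using mean_mono[of "\<lambda>_. 0" g] assms by simp

lemma mean_norm_le:
  assumes "continuous_on {0..2 * pi} g"
  shows "norm (mean g) \<le> mean (\<lambda>t. norm (g t))"
  using assms
  by (auto simp: mean_def intro!: divide_right_mono integral_norm_bound_integral
      integrable_continuous_real continuous_intros)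

lemma mean_eq_0_imp:
  fixes g :: "real \<Rightarrow> real"
  assumes "continuous_on {0..2 * pi} g" "\<And>t. t \<in> {0..2 * pi} \<Longrightarrow> 0 \<le> g t" "mean g = 0"
    "t \<in> {0..2 * pi}"
  shows "g t = 0"
  using integral_eq_0_iff[of 0 "2 * pi" g] assms by (auto simp: mean_def)

lemma mean_pos:
  fixes g :: "real \<Rightarrow> real"
  assumes "continuous_on {0..2 * pi} g" "\<And>t. t \<in> {0..2 * pi} \<Longrightarrow> 0 < g t"
  shows "0 < mean g"
proof -
  have "0 \<le> mean g" using assms by (intro mean_nonneg) (auto intro: less_imp_le)
  moreover have "mean g \<noteq> 0"
  proof
    assume "mean g = 0"
    then have "g 0 = 0" using assms by (intro mean_eq_0_imp[of g 0]) (auto intro: less_imp_le)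
    with assms(2)[of 0] show False by simp
  qed
  ultimately show ?thesis by simp
qed

text \<open>Hoelder's inequality with conjugate exponents \<open>1 / (1 - \<theta>)\<close> and \<open>1 / \<theta>\<close>, the roots already taken.
Young's inequality is applied pointwise to \<open>u / mean u\<close> and \<open>v / mean v\<close>, whose means are \<open>1\<close>.\<close>
lemma mean_Hoelder:
  fixes u v :: "real \<Rightarrow> real"
  assumes cont: "continuous_on {0..2 * pi} u" "continuous_on {0..2 * pi} v"
    and pos: "\<And>t. t \<in> {0..2 * pi} \<Longrightarrow> 0 < u t" "\<And>t. t \<in> {0..2 * pi} \<Longrightarrow> 0 \<le> v t"
    and \<theta>: "0 < \<theta>" "\<theta> < 1"
  shows "mean (\<lambda>t. u t powr (1 - \<theta>) * v t powr \<theta>) \<le> mean u powr (1 - \<theta>) * mean v powr \<theta>"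
proof (cases "mean v = 0")
  case True
  then have "v t = 0" if "t \<in> {0..2 * pi}" for t
    using mean_eq_0_imp[OF cont(2) pos(2)] that by blast
  then have "mean (\<lambda>t. u t powr (1 - \<theta>) * v t powr \<theta>) = mean (\<lambda>t. 0)"
    by (intro mean_cong) auto
  then show ?thesis by simp
next
  case False
  define U V where "U = mean u" and "V = mean v"
  have U: "U > 0" unfolding U_def using cont pos by (intro mean_pos)
  have V: "V > 0" unfolding V_def using False mean_nonneg[OF cont(2) pos(2)] by force
  have *: "u t powr (1 - \<theta>) * v t powr \<theta>
        \<le> U powr (1 - \<theta>) * V powr \<theta> * ((1 - \<theta>) / U * u t + \<theta> / V * v t)"
    if t: "t \<in> {0..2 * pi}" for t
  proof (cases "v t = 0")
    case True
    then show ?thesis using U V \<theta> pos(1)[OF t] by auto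
  next
    case False
    then have "v t > 0" using pos(2)[OF t] by simp
    then have "(u t / U) powr (1 - \<theta>) * (v t / V) powr \<theta> \<le> (1 - \<theta>) * (u t / U) + \<theta> * (v t / V)"
      using \<theta> U V pos(1)[OF t] by (intro Youngs_inequality_0) auto
    then show ?thesis
      using U V pos(1)[OF t] \<open>v t > 0\<close> by (simp add: powr_divide field_simps)
  qed
  have "mean (\<lambda>t. u t powr (1 - \<theta>) * v t powr \<theta>)
      \<le> mean (\<lambda>t. U powr (1 - \<theta>) * V powr \<theta> * ((1 - \<theta>) / U * u t + \<theta> / V * v t))"
    using cont * pos \<theta>
    by (intro mean_mono continuous_intros continuous_on_powr') (auto simp: less_imp_neq[symmetric] less_imp_le)
  also have "\<dots> = U powr (1 - \<theta>) * V powr \<theta> * ((1 - \<theta>) / U * mean u + \<theta> / V * mean v)"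
  proof -
    have "mean (\<lambda>t. U powr (1 - \<theta>) * V powr \<theta> * ((1 - \<theta>) / U * u t + \<theta> / V * v t))
        = U powr (1 - \<theta>) * V powr \<theta> * mean (\<lambda>t. (1 - \<theta>) / U * u t + \<theta> / V * v t)"
      by (intro mean_cmult continuous_intros cont)
    also have "mean (\<lambda>t. (1 - \<theta>) / U * u t + \<theta> / V * v t)
        = mean (\<lambda>t. (1 - \<theta>) / U * u t) + mean (\<lambda>t. \<theta> / V * v t)"
      by (intro mean_add continuous_intros cont)
    finally show ?thesis by (simp only: mean_cmult cont)
  qed
  also have "\<dots> = U powr (1 - \<theta>) * V powr \<theta>"
    using U V by (simp add: U_def[symmetric] V_def[symmetric])
  finally show ?thesis by (simp add: U_def V_def)
qed

lemma mean_has_field_derivative: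
  fixes f :: "real \<Rightarrow> real \<Rightarrow> real"
  assumes "\<And>x t. t \<in> {0..2 * pi} \<Longrightarrow> ((\<lambda>x. f x t) has_field_derivative f' x t) (at x)"
    and "\<And>x. continuous_on {0..2 * pi} (f x)"
    and "continuous_on (UNIV \<times> {0..2 * pi}) (\<lambda>(x, t). f' x t)"
  shows "((\<lambda>x. mean (f x)) has_field_derivative mean (f' x)) (at x)"
proof -
  have "((\<lambda>x. integral (cbox 0 (2 * pi)) (f x)) has_field_derivative
         integral (cbox 0 (2 * pi)) (f' x)) (at x)"
    using assms by (intro leibniz_rule_field_derivative integrable_continuous) auto
  from DERIV_cmult[OF this, of "1 / (2 * pi)"] show ?thesis
    by (simp add: mean_def)
qed

text \<open>The 2-uniform smoothness of \<open>L\<^sup>p\<close>, in the case of a constant perturbed by a function of mean zero.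
Along the segment \<open>x \<mapsto> a + x g\<close> the squared norm \<open>\<phi> x = (mean |a + x g|\<^sup>p)\<^bsup>2/p\<^esup>\<close> has second
derivative at most \<open>2 (p - 1) \<parallel>g\<parallel>\<^sup>2\<close>, by Hoelder's inequality, and its derivative at \<open>0\<close> is a multiple
of \<open>Re (cnj a * mean g) = 0\<close>. Integrating twice over \<open>[0, 1]\<close> gives the claim.

Since \<open>|a + x g|\<^sup>p\<close> need not be smooth where \<open>a + x g\<close> vanishes, \<open>|a + x g|\<^sup>2\<close> is replaced by
\<open>Q x t = |a + x g t|\<^sup>2 + e\<close> with \<open>e > 0\<close>. This raises the value at \<open>x = 1\<close> and adds just \<open>e\<close> to
the value at \<open>x = 0\<close>, so \<open>e\<close> can be dropped at the end.\<close>
lemma mean_norm_powr_smooth: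
  fixes g :: "real \<Rightarrow> complex" and a :: complex
  assumes p: "2 < p" and g: "continuous_on {0..2 * pi} g" and g0: "mean g = 0"
  shows "mean (\<lambda>t. norm (a + g t) powr p) powr (2 / p)
       \<le> (norm a)\<^sup>2 + (p - 1) * mean (\<lambda>t. norm (g t) powr p) powr (2 / p)"
    (is "?L powr _ \<le> _ + _ * ?N")
proof (rule field_le_epsilon)
  fix e :: real assume e: "e > 0"
  define s where "s = p / 2"
  have s: "s > 1" using p by (simp add: s_def)
  define b c where "b = (\<lambda>t. Re (cnj a * g t))" and "c = (\<lambda>t. (norm (g t))\<^sup>2)"
  define A where "A = (norm a)\<^sup>2 + e"
  define Q where "Q = (\<lambda>x t. A + 2 * x * b t + x\<^sup>2 * c t)"
  define Q' where "Q' = (\<lambda>x t. 2 * b t + 2 * x * c t)"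
  have cont_bc: "continuous_on {0..2 * pi} b" "continuous_on {0..2 * pi} c"
    unfolding b_def c_def by (intro continuous_intros g)+
  have cont_snd: "continuous_on (UNIV \<times> {0..2 * pi}) (\<lambda>z. b (snd z))"
     "continuous_on (UNIV \<times> {0..2 * pi}) (\<lambda>z. c (snd z))"
    by (intro continuous_on_compose2[OF cont_bc(1)] continuous_on_compose2[OF cont_bc(2)]
        continuous_intros; auto)+
  have Q_eq: "Q x t = (norm (a + of_real x * g t))\<^sup>2 + e" for x t
  proof -
    have "(norm (a + of_real x * g t))\<^sup>2 = (Re a + x * Re (g t))\<^sup>2 + (Im a + x * Im (g t))\<^sup>2"
      by (simp add: cmod_power2)
    then show ?thesis
      unfolding Q_def A_def b_def c_def by (simp add: cmod_power2) algebra
  qed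
  have Q_pos: "Q x t > 0" for x t
    using e unfolding Q_eq by (simp add: add_nonneg_pos)
  have c_nonneg: "c t \<ge> 0" for t by (simp add: c_def)
  \<comment> \<open>Cauchy-Schwarz for \<open>Q' x t = 2 Re (cnj (a + x g) g)\<close>; it turns the first term of the second
    derivative of \<open>Q powr s\<close> into a multiple of the second one.\<close>
  have Q'_sq: "(Q' x t)\<^sup>2 \<le> 4 * c t * Q x t" for x t
  proof -
    have "\<bar>b t\<bar> \<le> norm a * norm (g t)"
      unfolding b_def using abs_Re_le_cmod[of "cnj a * g t"] by (simp add: norm_mult)
    then have "(b t)\<^sup>2 \<le> (norm a * norm (g t))\<^sup>2" by (metis abs_ge_zero power2_abs power_mono)
    then have "(b t)\<^sup>2 \<le> (norm a)\<^sup>2 * c t" by (simp add: c_def power_mult_distrib)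
    moreover have "e * c t \<ge> 0" using e c_nonneg by simp
    ultimately show ?thesis by (simp add: Q_def Q'_def A_def power2_eq_square algebra_simps)
  qed
  have DQ: "((\<lambda>x. Q x t) has_field_derivative Q' x t) (at x)" for x t
    unfolding Q_def Q'_def by (auto intro!: derivative_eq_intros)
  have DQ': "((\<lambda>x. Q' x t) has_field_derivative 2 * c t) (at x)" for x t
    unfolding Q'_def by (auto intro!: derivative_eq_intros)
  have contQ: "continuous_on {0..2 * pi} (Q x)" "continuous_on {0..2 * pi} (Q' x)" for x
    unfolding Q_def Q'_def by (intro continuous_intros cont_bc)+
  have contQ2: "continuous_on (UNIV \<times> {0..2 * pi}) (\<lambda>z. Q (fst z) (snd z))"
     "continuous_on (UNIV \<times> {0..2 * pi}) (\<lambda>z. Q' (fst z) (snd z))"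
    unfolding Q_def Q'_def by (intro continuous_intros cont_snd)+
  have Q_nz: "Q x t \<noteq> 0" for x t using Q_pos[of x t] by simp
  define F1 where "F1 = (\<lambda>x t. s * Q x t powr (s - 1) * Q' x t)"
  define F2 where "F2 = (\<lambda>x t. s * (s - 1) * Q x t powr (s - 2) * (Q' x t)\<^sup>2
                               + s * Q x t powr (s - 1) * (2 * c t))"
  define \<psi> where "\<psi> = (\<lambda>x. mean (\<lambda>t. Q x t powr s))"
  have D1: "(\<psi> has_field_derivative mean (F1 x)) (at x)" for x
    unfolding \<psi>_def
  proof (rule mean_has_field_derivative)
    show "((\<lambda>x. Q x t powr s) has_field_derivative F1 x t) (at x)" for x t
      using DERIV_fun_powr[OF DQ Q_pos, of t s x] by (simp add: F1_def)
    show "continuous_on {0..2 * pi} (\<lambda>t. Q x t powr s)" for x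
      using Q_nz by (intro continuous_intros contQ) auto
    show "continuous_on (UNIV \<times> {0..2 * pi}) (\<lambda>(x, t). F1 x t)"
      unfolding F1_def split_beta using Q_nz by (intro continuous_intros contQ2) auto
  qed
  have D2: "((\<lambda>x. mean (F1 x)) has_field_derivative mean (F2 x)) (at x)" for x
  proof (rule mean_has_field_derivative)
    show "((\<lambda>x. F1 x t) has_field_derivative F2 x t) (at x)" for x t
      unfolding F1_def F2_def
      using DERIV_mult[OF DERIV_cmult[OF DERIV_fun_powr[OF DQ Q_pos, of t "s - 1" x], of s] DQ'[of t x]]
      by (simp add: power2_eq_square algebra_simps)
    show "continuous_on {0..2 * pi} (F1 x)" for x
      unfolding F1_def using Q_nz by (intro continuous_intros contQ) auto
    show "continuous_on (UNIV \<times> {0..2 * pi}) (\<lambda>(x, t). F2 x t)"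
      unfolding F2_def split_beta using Q_nz by (intro continuous_intros contQ2 cont_snd) auto
  qed
  have \<psi>_pos: "\<psi> x > 0" for x
    unfolding \<psi>_def using Q_nz Q_pos by (intro mean_pos continuous_intros contQ) auto
  have contQs: "continuous_on {0..2 * pi} (\<lambda>t. Q x t powr r)"
    "continuous_on {0..2 * pi} (\<lambda>t. (Q x t powr r) powr r')" for x r r'
    using Q_nz by (intro continuous_intros contQ; simp)+
  have contcs: "continuous_on {0..2 * pi} (\<lambda>t. c t powr s)"
    using s c_nonneg by (intro continuous_on_powr' cont_bc continuous_intros) auto
  have contcs': "continuous_on {0..2 * pi} (\<lambda>t. (c t powr s) powr (1 / s))"
    using s by (intro continuous_on_powr' contcs continuous_intros) auto
  define N where "N = mean (\<lambda>t. c t powr s) powr (1 / s)"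
  have N_eq: "N = ?N"
    using p by (simp add: N_def c_def s_def powr_powr flip: powr_numeral)
  \<comment> \<open>The coefficients add up: \<open>4 s (s - 1) + 2 s = 2 s (2 s - 1) = p (p - 1)\<close>.\<close>
  have F2_le: "mean (F2 x) \<le> p * (p - 1) * (\<psi> x powr (1 - 1 / s) * N)" for x
  proof -
    have "F2 x t \<le> p * (p - 1) * ((Q x t powr s) powr (1 - 1 / s) * (c t powr s) powr (1 / s))" for t
    proof -
      have "Q x t powr (s - 2) * (Q' x t)\<^sup>2 \<le> Q x t powr (s - 2) * (4 * c t * Q x t)"
        by (intro mult_left_mono Q'_sq) auto
      also have "\<dots> = 4 * c t * Q x t powr (s - 1)"
        using Q_pos[of x t] powr_add[of "Q x t" "s - 2" 1] by (simp add: mult_ac)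
      finally have "s * (s - 1) * (Q x t powr (s - 2) * (Q' x t)\<^sup>2) \<le> s * (s - 1) * (4 * c t * Q x t powr (s - 1))"
        using s by (intro mult_left_mono) auto
      then have "F2 x t \<le> s * (s - 1) * (4 * c t * Q x t powr (s - 1)) + s * Q x t powr (s - 1) * (2 * c t)"
        unfolding F2_def mult.assoc by linarith
      also have "\<dots> = (2 * s) * (2 * s - 1) * (Q x t powr (s - 1) * c t)"
        by algebra
      also have "Q x t powr (s - 1) = (Q x t powr s) powr (1 - 1 / s)"
        using s by (simp add: powr_powr right_diff_distrib)
      also have "c t = (c t powr s) powr (1 / s)"
        using s c_nonneg[of t] by (simp add: powr_powr)
      also have "2 * s = p" by (simp add: s_def)
      finally show ?thesis .
    qed
    then have "mean (F2 x) \<le> mean (\<lambda>t. p * (p - 1) * ((Q x t powr s) powr (1 - 1 / s) * (c t powr s) powr (1 / s)))"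
    proof (intro mean_mono)
      show "continuous_on {0..2 * pi} (F2 x)"
        unfolding F2_def
        by (intro continuous_on_add continuous_on_mult continuous_on_const continuous_on_power
            contQ cont_bc contQs)
    qed (intro continuous_on_mult continuous_on_const contQs contcs')
    also have "\<dots> = p * (p - 1) * mean (\<lambda>t. (Q x t powr s) powr (1 - 1 / s) * (c t powr s) powr (1 / s))"
      by (intro mean_cmult continuous_on_mult contQs contcs')
    also have "\<dots> \<le> p * (p - 1) * (\<psi> x powr (1 - 1 / s) * N)"
    proof (intro mult_left_mono)
      show "mean (\<lambda>t. (Q x t powr s) powr (1 - 1 / s) * (c t powr s) powr (1 / s)) \<le> \<psi> x powr (1 - 1 / s) * N"
        unfolding \<psi>_def N_def using Q_nz s by (intro mean_Hoelder contQs contcs) auto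
    qed (use p in auto)
    finally show ?thesis .
  qed
  define \<phi>' where "\<phi>' = (\<lambda>x. 1 / s * \<psi> x powr (1 / s - 1) * mean (F1 x))"
  define \<phi>'' where "\<phi>'' = (\<lambda>x. 1 / s * (1 / s - 1) * \<psi> x powr (1 / s - 2) * (mean (F1 x))\<^sup>2
                               + 1 / s * \<psi> x powr (1 / s - 1) * mean (F2 x))"
  have E1: "((\<lambda>x. \<psi> x powr (1 / s)) has_field_derivative \<phi>' x) (at x)" for x
    using DERIV_fun_powr[OF D1[of x] \<psi>_pos[of x], of "1 / s"] by (simp add: \<phi>'_def)
  have E2: "(\<phi>' has_field_derivative \<phi>'' x) (at x)" for x
    unfolding \<phi>'_def \<phi>''_def
    using DERIV_mult[OF DERIV_cmult[OF DERIV_fun_powr[OF D1[of x] \<psi>_pos[of x], of "1 / s - 1"], of "1 / s"] D2[of x]]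
    by (simp add: power2_eq_square algebra_simps)
  have \<phi>''_le: "\<phi>'' x \<le> 2 * (p - 1) * N" for x
  proof -
    \<comment> \<open>The term with \<open>\<psi>'\<^sup>2\<close> has a favourable sign because \<open>1 / s < 1\<close>.\<close>
    have "1 / s * (1 / s - 1) \<le> 0" using s by (intro mult_nonneg_nonpos) auto
    then have "1 / s * (1 / s - 1) * (\<psi> x powr (1 / s - 2) * (mean (F1 x))\<^sup>2) \<le> 0"
      by (rule mult_nonpos_nonneg) auto
    then have "\<phi>'' x \<le> 1 / s * \<psi> x powr (1 / s - 1) * mean (F2 x)"
      unfolding \<phi>''_def by (simp only: mult.assoc)
    also have "\<dots> \<le> 1 / s * \<psi> x powr (1 / s - 1) * (p * (p - 1) * (\<psi> x powr (1 - 1 / s) * N))"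
      using s by (intro mult_left_mono F2_le) auto
    also have "\<dots> = 1 / s * (p * (p - 1) * N) * \<psi> x powr ((1 / s - 1) + (1 - 1 / s))"
      unfolding powr_add by (simp only: mult_ac)
    also have "\<dots> = 2 * (p - 1) * N"
      using \<psi>_pos[of x] p by (simp add: s_def field_simps)
    finally show ?thesis .
  qed
  have \<phi>'0: "\<phi>' 0 = 0"
  proof -
    have "mean b = Re (mean (\<lambda>t. cnj a * g t))"
      unfolding b_def by (intro mean_linear bounded_linear_Re continuous_intros g)
    also have "mean (\<lambda>t. cnj a * g t) = 0"
      using g0 by (simp add: mean_cmult g)
    finally have "mean b = 0" by simp
    moreover have "mean (F1 0) = s * A powr (s - 1) * 2 * mean b"
      unfolding mean_cmult[OF cont_bc(1), symmetric]
      by (simp add: F1_def Q_def Q'_def mult_ac)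
    ultimately show ?thesis by (simp add: \<phi>'_def)
  qed
  have slope: "\<phi>' x - 2 * (p - 1) * N * x \<le> 0" if "x \<ge> 0" for x
  proof -
    have "\<phi>' x - 2 * (p - 1) * N * x \<le> \<phi>' 0 - 2 * (p - 1) * N * 0"
    proof (rule DERIV_nonpos_imp_nonincreasing[OF that])
      fix y
      show "\<exists>d. ((\<lambda>x. \<phi>' x - 2 * (p - 1) * N * x) has_field_derivative d) (at y) \<and> d \<le> 0"
        using \<phi>''_le[of y]
        by (intro exI[of _ "\<phi>'' y - 2 * (p - 1) * N"]) (auto intro!: derivative_eq_intros E2)
    qed
    then show ?thesis using \<phi>'0 by simp
  qed
  have "\<psi> 1 powr (1 / s) - (p - 1) * N * 1\<^sup>2 \<le> \<psi> 0 powr (1 / s) - (p - 1) * N * 0\<^sup>2"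
  proof (rule DERIV_nonpos_imp_nonincreasing[where f = "\<lambda>x. \<psi> x powr (1 / s) - (p - 1) * N * x\<^sup>2"])
    fix y :: real assume y: "0 \<le> y"
    have "((\<lambda>x. (p - 1) * N * x\<^sup>2) has_field_derivative 2 * (p - 1) * N * y) (at y)"
      by (auto intro!: derivative_eq_intros)
    from DERIV_diff[OF E1[of y] this]
    show "\<exists>d. ((\<lambda>x. \<psi> x powr (1 / s) - (p - 1) * N * x\<^sup>2) has_field_derivative d) (at y) \<and> d \<le> 0"
      using slope[OF y] by blast
  qed auto
  moreover have "\<psi> 0 powr (1 / s) = A"
    using s e by (simp add: \<psi>_def Q_def powr_powr A_def add_nonneg_pos less_imp_le)
  moreover have "?L powr (2 / p) \<le> \<psi> 1 powr (1 / s)"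
  proof -
    have contL: "continuous_on {0..2 * pi} (\<lambda>t. norm (a + g t) powr p)"
      using p by (intro continuous_on_powr' continuous_intros g) auto
    have "norm (a + g t) powr p \<le> Q 1 t powr s" for t
    proof -
      have "norm (a + g t) powr p = ((norm (a + g t))\<^sup>2) powr s"
        using p by (simp add: s_def powr_powr flip: powr_numeral)
      also have "\<dots> \<le> Q 1 t powr s"
        unfolding Q_eq using s e by (intro powr_mono2) auto
      finally show ?thesis .
    qed
    then have "?L \<le> \<psi> 1"
      unfolding \<psi>_def by (rule mean_mono[OF contL contQs(1)])
    moreover have "?L \<ge> 0"
      by (intro mean_nonneg contL) simp
    ultimately show ?thesis
      using p by (simp add: s_def powr_mono2)
  qed
  ultimately show "?L powr (2 / p) \<le> (norm a)\<^sup>2 + (p - 1) * ?N + e"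
    unfolding N_eq A_def by simp
qed

section \<open>Holomorphic functions on circles\<close>

lemma continuous_on_circle:
  assumes "continuous_on (ball 0 1) \<phi>" "0 < r" "r < 1"
  shows "continuous_on S (\<lambda>t. \<phi> (of_real r * cis t))"
  using assms(2,3)
  by (intro continuous_on_compose2[OF assms(1)]) (auto intro!: continuous_intros simp: norm_mult)

lemma Cauchy_formula_mean:
  assumes f: "f holomorphic_on ball 0 1" and r: "norm w < r" "r < 1"
  shows "mean (\<lambda>t. f (of_real r * cis t) * (of_real r * cis t) / (of_real r * cis t - w)) = f w"
proof -
  have "r > 0" using r(1) norm_ge_zero[of w] by linarith
  have "f holomorphic_on cball 0 r"
    using f r by (rule_tac holomorphic_on_subset) auto
  then have "((\<lambda>u. f u / (u - w)) has_contour_integral (2 * of_real pi * \<i> * f w)) (circlepath 0 r)"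
    using r by (intro Cauchy_integral_circlepath_simple) auto
  then have "((\<lambda>t. f (of_real r * cis t) / (of_real r * cis t - w) * of_real r * \<i> * cis t)
      has_integral (2 * of_real pi * \<i> * f w)) {0..2 * pi}"
    unfolding circlepath_def by (subst (asm) has_contour_integral_part_circlepath_iff) auto
  from has_integral_mult_right[OF this, of "1 / (2 * of_real pi * \<i>)"]
  have "((\<lambda>t. (f (of_real r * cis t) * (of_real r * cis t) / (of_real r * cis t - w)) / (2 * of_real pi))
      has_integral f w) {0..2 * pi}"
    by (simp add: mult_ac)
  then have "integral {0..2 * pi} (\<lambda>t. (f (of_real r * cis t) * (of_real r * cis t) / (of_real r * cis t - w)) / (2 * of_real pi)) = f w"
    by (rule integral_unique)
  then show ?thesis
    unfolding integral_divide by (simp add: mean_def scaleR_conv_of_real)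
qed

lemma mean_holomorphic:
  assumes "f holomorphic_on ball 0 1" "0 < r" "r < 1"
  shows "mean (\<lambda>t. f (of_real r * cis t)) = f 0"
  using Cauchy_formula_mean[OF assms(1), of 0 r] assms(2,3) by simp

text \<open>Cauchy's formula with the kernel estimated trivially. The constant exceeds \<open>1\<close>, but it does not
depend on \<open>f\<close>; applied to the powers of a function it disappears on taking roots.\<close>
lemma norm_holomorphic_le_mean:
  assumes f: "f holomorphic_on ball 0 1" and r: "norm w < r" "r < 1"
  shows "norm (f w) \<le> r / (r - norm w) * mean (\<lambda>t. norm (f (of_real r * cis t)))"
proof -
  have r0: "r > 0" using r(1) norm_ge_zero[of w] by linarith
  have cf: "continuous_on S (\<lambda>t. f (of_real r * cis t))" for S
    using r r0 by (intro continuous_on_circle holomorphic_on_imp_continuous_on f)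
  have lower: "r - norm w \<le> norm (of_real r * cis t - w)" for t
    using norm_triangle_ineq2[of "of_real r * cis t" w] r0 by (simp add: norm_mult)
  have nz: "of_real r * cis t - w \<noteq> 0" for t
    using lower[of t] r by auto
  let ?h = "\<lambda>t. f (of_real r * cis t) * (of_real r * cis t) / (of_real r * cis t - w)"
  have ch: "continuous_on S ?h" for S
    using nz by (intro continuous_intros cf) auto
  have "norm (f w) = norm (mean ?h)"
    using Cauchy_formula_mean[OF f r] by simp
  also have "\<dots> \<le> mean (\<lambda>t. norm (?h t))"
    by (intro mean_norm_le ch)
  also have "\<dots> \<le> mean (\<lambda>t. r / (r - norm w) * norm (f (of_real r * cis t)))"
  proof (rule mean_mono)
    show "norm (?h t) \<le> r / (r - norm w) * norm (f (of_real r * cis t))" for t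
      using lower[of t] r r0 by (auto simp: norm_mult norm_divide intro!: frac_le mult_nonneg_nonneg)
  qed (intro continuous_intros ch cf)+
  also have "\<dots> = r / (r - norm w) * mean (\<lambda>t. norm (f (of_real r * cis t)))"
    by (intro mean_cmult continuous_intros cf)
  finally show ?thesis .
qed

section \<open>Inner functions and Blaschke products\<close>

text \<open>Dominated convergence: the integrands are bounded and tend to \<open>1\<close> along almost every radius. This
is the only way in which the boundary values of an inner function enter the argument.\<close>
lemma inner_mean_tendsto:
  assumes "inner_function I"
  shows "((\<lambda>r. mean (\<lambda>t. norm (I (of_real r * cis t)) ^ n)) \<longlongrightarrow> 1) (at_left 1)"
proof (rule tendsto_at_left_sequentially[of 0])
  fix S :: "nat \<Rightarrow> real"
  assume S: "\<And>n. S n < 1" "\<And>n. 0 < S n" "incseq S" "S \<longlonglongrightarrow> 1"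
  from assms have hol: "I holomorphic_on ball 0 1" and bdd: "bounded (I ` ball 0 1)"
    and AE: "AE t in lebesgue. \<exists>b. ((\<lambda>r. I (of_real r * cis t)) \<longlongrightarrow> b) (at_left 1) \<and> norm b = 1"
    by (auto simp: inner_function_def)
  obtain M where M: "\<And>z. z \<in> ball 0 1 \<Longrightarrow> norm (I z) \<le> M"
    using bdd unfolding bounded_iff by blast
  obtain Z where Z: "Z \<in> null_sets lebesgue"
    and "{t. \<not> (\<exists>b. ((\<lambda>r. I (of_real r * cis t)) \<longlongrightarrow> b) (at_left 1) \<and> norm b = 1)} \<subseteq> Z"
    using AE unfolding eventually_ae_filter by auto
  then have ZI: "\<exists>b. ((\<lambda>r. I (of_real r * cis t)) \<longlongrightarrow> b) (at_left 1) \<and> norm b = 1" if "t \<notin> Z" for t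
    using that by blast
  have negl: "negligible Z" using Z by (simp add: negligible_iff_null_sets)
  have spike: "negligible {t \<in> A. t \<in> Z}" for A
    using negl by (rule negligible_subset) auto
  define D where "D = {0..2 * pi} - Z"
  define g where "g = (\<lambda>k t. norm (I (of_real (S k) * cis t)) ^ n)"
  have cont: "continuous_on {0..2 * pi} (g k)" for k
    unfolding g_def using S by (intro continuous_intros continuous_on_circle holomorphic_on_imp_continuous_on hol)
  have to_D: "f integrable_on D" "integral D f = integral {0..2 * pi} f"
    if "continuous_on {0..2 * pi} f" for f :: "real \<Rightarrow> real"
  proof -
    have "f integrable_on {0..2 * pi}" using that by (rule integrable_continuous_real)
    then show "f integrable_on D"
      by (rule integrable_spike_set) (auto simp: D_def intro: negligible_subset[OF negl])
    show "integral D f = integral {0..2 * pi} f"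
      by (rule integral_spike_set) (auto simp: D_def intro: negligible_subset[OF negl])
  qed
  have "(\<lambda>k. integral D (g k)) \<longlonglongrightarrow> integral D (\<lambda>_. 1)"
  proof (rule dominated_convergence(2))
    show "g k integrable_on D" for k by (rule to_D(1)[OF cont])
    show "(\<lambda>_. M ^ n) integrable_on D" by (rule to_D(1)) simp
    show "norm (g k t) \<le> M ^ n" for k t
      unfolding g_def using S(1)[of k] S(2)[of k] by (auto simp: norm_mult intro!: power_mono M)
    show "(\<lambda>k. g k t) \<longlonglongrightarrow> 1" if t: "t \<in> D" for t
    proof -
      obtain b where b: "((\<lambda>r. I (of_real r * cis t)) \<longlongrightarrow> b) (at_left 1)" "norm b = 1"
        using ZI[of t] t by (auto simp: D_def)
      have "filterlim S (at_left 1) sequentially"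
        unfolding filterlim_at using S by (auto simp: less_imp_neq)
      with b(1) have "(\<lambda>k. I (of_real (S k) * cis t)) \<longlonglongrightarrow> b"
        by (rule filterlim_compose)
      then have "(\<lambda>k. g k t) \<longlonglongrightarrow> norm b ^ n"
        unfolding g_def by (intro tendsto_intros)
      then show ?thesis using b(2) by simp
    qed
  qed
  then have "(\<lambda>k. integral {0..2 * pi} (g k)) \<longlonglongrightarrow> integral {0..2 * pi} (\<lambda>_. 1)"
    using to_D(2)[OF cont] to_D(2)[of "\<lambda>_. 1"] by simp
  then have "(\<lambda>k. mean (g k)) \<longlonglongrightarrow> mean (\<lambda>_. 1)"
    unfolding mean_def by (intro tendsto_intros)
  then show "(\<lambda>k. mean (\<lambda>t. norm (I (of_real (S k) * cis t)) ^ n)) \<longlonglongrightarrow> 1"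
    by (simp add: g_def)
qed simp

text \<open>By Cauchy's formula at radius \<open>r \<rightarrow> 1\<close>, every power satisfies \<open>|I z|\<^sup>n \<le> 1 / (1 - |z|)\<close>, with a bound
independent of \<open>n\<close>.\<close>
lemma inner_norm_le_1:
  assumes "inner_function I" "z \<in> ball 0 1"
  shows "norm (I z) \<le> 1"
proof (rule ccontr)
  assume "\<not> norm (I z) \<le> 1"
  then have "norm (I z) > 1" by simp
  from real_arch_pow[OF this, of "1 / (1 - norm z)"]
  obtain n where n: "1 / (1 - norm z) < norm (I z) ^ n" by auto
  have hol: "I holomorphic_on ball 0 1" using assms by (simp add: inner_function_def)
  have z: "norm z < 1" using assms by simp
  have "((\<lambda>r. r / (r - norm z) * mean (\<lambda>t. norm (I (of_real r * cis t)) ^ n)) \<longlongrightarrow> 1 / (1 - norm z) * 1) (at_left 1)"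
    using z by (intro tendsto_intros inner_mean_tendsto assms) auto
  moreover have "\<forall>\<^sub>F r in at_left 1. norm (I z) ^ n \<le> r / (r - norm z) * mean (\<lambda>t. norm (I (of_real r * cis t)) ^ n)"
    using eventually_at_left_real[OF z]
  proof eventually_elim
    case (elim r)
    then show ?case
      using norm_holomorphic_le_mean[of "\<lambda>z. I z ^ n" z r] hol
      by (auto simp: norm_power intro: holomorphic_intros)
  qed
  ultimately have "norm (I z) ^ n \<le> 1 / (1 - norm z) * 1"
    by (rule tendsto_lowerbound) simp
  with n show False by simp
qed

lemma inner_function_mult:
  assumes "inner_function I" "inner_function K"
  shows "inner_function (\<lambda>z. I z * K z)"
proof -
  have "norm (I z * K z) \<le> 1" if "z \<in> ball 0 1" for z
    unfolding norm_mult by (intro mult_le_one inner_norm_le_1 assms that) auto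
  then have "bounded ((\<lambda>z. I z * K z) ` ball 0 1)"
    unfolding bounded_iff by blast
  moreover have "AE t in lebesgue. \<exists>b. ((\<lambda>r. I (of_real r * cis t) * K (of_real r * cis t)) \<longlongrightarrow> b) (at_left 1) \<and> norm b = 1"
  proof -
    have "AE t in lebesgue. \<exists>b. ((\<lambda>r. I (of_real r * cis t)) \<longlongrightarrow> b) (at_left 1) \<and> norm b = 1"
         "AE t in lebesgue. \<exists>b. ((\<lambda>r. K (of_real r * cis t)) \<longlongrightarrow> b) (at_left 1) \<and> norm b = 1"
      using assms by (auto simp: inner_function_def)
    then show ?thesis
    proof eventually_elim
      case (elim t)
      then obtain b c where "((\<lambda>r. I (of_real r * cis t)) \<longlongrightarrow> b) (at_left 1)" "norm b = 1"
        "((\<lambda>r. K (of_real r * cis t)) \<longlongrightarrow> c) (at_left 1)" "norm c = 1" by auto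
      then show ?case
        by (intro exI[of _ "b * c"]) (auto intro!: tendsto_mult simp: norm_mult)
    qed
  qed
  ultimately show ?thesis
    using assms by (auto simp: inner_function_def intro!: holomorphic_intros)
qed

lemma inner_function_Moebius:
  assumes w: "norm w < 1"
  shows "inner_function (Moebius_function 0 w)"
  unfolding inner_function_def
proof (intro conjI AE_I2)
  show "Moebius_function 0 w holomorphic_on ball 0 1"
    by (rule Moebius_function_holomorphic[OF w])
  show "bounded (Moebius_function 0 w ` ball 0 1)"
    unfolding bounded_iff using Moebius_function_norm_lt_1[OF w] by (auto intro!: exI[of _ 1] less_imp_le)
  fix t
  let ?u = "cis t"
  have u: "cnj ?u * ?u = 1" by (simp add: cis_cnj cis_mult)
  have nz: "1 - cnj w * ?u \<noteq> 0"
  proof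
    assume "1 - cnj w * ?u = 0"
    then have "norm (cnj w * ?u) = 1" by (metis norm_one right_minus_eq)
    then show False using w by (simp add: norm_mult)
  qed
  \<comment> \<open>On the unit circle numerator and denominator have the same modulus.\<close>
  have "?u - w = ?u * cnj (1 - cnj w * ?u)"
    using u by (simp add: algebra_simps)
  then have "norm (?u - w) = norm (1 - cnj w * ?u)"
    by (metis complex_mod_cnj mult_1 norm_cis norm_mult)
  then have "norm (Moebius_function 0 w ?u) = 1"
    using nz by (simp add: Moebius_function_simple norm_divide)
  moreover have "((\<lambda>r. Moebius_function 0 w (of_real r * ?u)) \<longlongrightarrow> Moebius_function 0 w (of_real 1 * ?u)) (at_left 1)"
    unfolding Moebius_function_simple using nz by (intro tendsto_intros) auto
  ultimately show "\<exists>b. ((\<lambda>r. Moebius_function 0 w (of_real r * ?u)) \<longlongrightarrow> b) (at_left 1) \<and> norm b = 1"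
    by auto
qed

lemma inner_function_Blaschke:
  assumes "\<And>w. w \<in># A \<Longrightarrow> norm w < 1"
  shows "inner_function (\<lambda>z. \<Prod>w\<in>#A. Moebius_function 0 w z)"
  using assms
proof (induction A)
  case empty
  have "inner_function (\<lambda>z. 1)"
    unfolding inner_function_def by (auto intro!: exI[of _ 1] simp: bounded_iff)
  then show ?case by simp
next
  case (add w A)
  then have "inner_function (\<lambda>z. Moebius_function 0 w z * (\<Prod>w\<in>#A. Moebius_function 0 w z))"
    by (intro inner_function_mult inner_function_Moebius) auto
  then show ?case by simp
qed

lemma norm_Blaschke_0: "norm (\<Prod>w\<in>#A. Moebius_function 0 w 0) = norm (\<Prod>w\<in>#A. w)"
  by (induction A) (auto simp: norm_mult Moebius_function_simple)

text \<open>Each factor \<open>z - w\<close> with \<open>|w| < 1\<close> is the Blaschke factor of \<open>w\<close> times \<open>1 - cnj w * z\<close>. The cofactor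
of the Blaschke product is thus again a polynomial, so multiplying by it preserves Hardy spaces.\<close>
lemma poly_disc_roots_factor:
  fixes q :: "complex poly"
  obtains P where "\<And>z. z \<in> ball 0 1 \<Longrightarrow>
    poly q z = (\<Prod>w\<in>#{#w \<in># proots q. w \<in> ball 0 1#}. Moebius_function 0 w z) * poly P z"
proof -
  define A where "A = {#w \<in># proots q. w \<in> ball 0 1#}"
  define C where "C = {#w \<in># proots q. w \<notin> ball 0 1#}"
  have lin: "poly (\<Prod>x\<in>#B. [:- x, 1:]) z
      = (\<Prod>w\<in>#B. Moebius_function 0 w z) * poly (\<Prod>w\<in>#B. [:1, - cnj w:]) z"
    if "z \<in> ball 0 1" "\<And>w. w \<in># B \<Longrightarrow> norm w < 1" for z B
    using that(2)
  proof (induction B)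
    case (add w B)
    have "norm (cnj w * z) < 1"
      using add.prems[of w] that(1) norm_mult_less[of "cnj w" 1 z 1] by simp
    then have "1 - cnj w * z \<noteq> 0" by auto
    then have "z - w = Moebius_function 0 w z * (1 - cnj w * z)"
      by (simp add: Moebius_function_simple)
    moreover have "poly (\<Prod>x\<in>#B. [:- x, 1:]) z
      = (\<Prod>w\<in>#B. Moebius_function 0 w z) * poly (\<Prod>w\<in>#B. [:1, - cnj w:]) z"
      using add by simp
    moreover have "(\<Prod>w\<in>#add_mset w B. Moebius_function 0 w z)
        = Moebius_function 0 w z * (\<Prod>w\<in>#B. Moebius_function 0 w z)"
      by simp
    moreover have "poly (\<Prod>x\<in>#add_mset w B. [:- x, 1:]) z = (z - w) * poly (\<Prod>x\<in>#B. [:- x, 1:]) z"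
      by (simp add: algebra_simps)
    moreover have "poly (\<Prod>w\<in>#add_mset w B. [:1, - cnj w:]) z = (1 - cnj w * z) * poly (\<Prod>w\<in>#B. [:1, - cnj w:]) z"
      by (simp add: algebra_simps)
    ultimately show ?case by (simp only: mult_ac)
  qed simp
  have "q = smult (lead_coeff q) (\<Prod>x\<in>#proots q. [:- x, 1:])"
    using complex_poly_decompose_multiset[of q] by simp
  also have "proots q = A + C" by (simp add: A_def C_def)
  finally have q: "poly q z = poly (\<Prod>x\<in>#A. [:- x, 1:]) z * poly (smult (lead_coeff q) (\<Prod>x\<in>#C. [:- x, 1:])) z" for z
    by (metis (no_types, lifting) image_mset_union mult_smult_right poly_mult prod_mset_Un)
  show ?thesis
    by (rule that[of "(\<Prod>w\<in>#A. [:1, - cnj w:]) * smult (lead_coeff q) (\<Prod>x\<in>#C. [:- x, 1:])"],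
        subst q, subst lin) (auto simp: A_def)
qed

section \<open>Hardy spaces\<close>

lemma
  assumes "f \<in> Hardy p"
  shows Hardy_holomorphic: "f holomorphic_on ball 0 1"
    and Hardy_bdd: "bdd_above (circle_mean p f ` {0<..<1})"
  using assms by (auto simp: Hardy_def)

lemma continuous_on_circle_powr:
  assumes "f holomorphic_on ball 0 1" "0 < r" "r < 1" "0 < p"
  shows "continuous_on S (\<lambda>t. norm (f (of_real r * cis t)) powr p)"
  using assms
  by (intro continuous_on_powr' continuous_intros continuous_on_circle holomorphic_on_imp_continuous_on) auto

lemma circle_mean_nonneg:
  assumes "f holomorphic_on ball 0 1" "0 < r" "r < 1" "0 < p"
  shows "0 \<le> circle_mean p f r"
  unfolding circle_mean_eq_mean by (intro mean_nonneg continuous_on_circle_powr assms) simp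

lemma circle_mean_le_Hardy_norm:
  assumes f: "f \<in> Hardy p" and p: "0 < p" and r: "r \<in> {0<..<1}"
  shows "circle_mean p f r \<le> Hardy_norm p f powr p"
proof -
  have "circle_mean p f r \<le> (SUP r\<in>{0<..<1}. circle_mean p f r)"
    by (rule cSUP_upper[OF r Hardy_bdd[OF f]])
  moreover have "0 \<le> circle_mean p f r"
    using r p by (intro circle_mean_nonneg Hardy_holomorphic[OF f]) auto
  ultimately show ?thesis
    using p by (simp add: Hardy_norm_def powr_powr)
qed

lemma Hardy_norm_nonneg: "0 \<le> Hardy_norm p f"
  by (simp add: Hardy_norm_def)

lemma Hardy_norm_le:
  assumes f: "f holomorphic_on ball 0 1" and p: "0 < p" and K: "0 \<le> K"
    and le: "\<And>r. r \<in> {0<..<1} \<Longrightarrow> circle_mean p f r \<le> K powr p"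
  shows "Hardy_norm p f \<le> K"
proof -
  have "(SUP r\<in>{0<..<1}. circle_mean p f r) \<le> K powr p"
    by (rule cSUP_least) (use le in auto)
  moreover have "0 \<le> (SUP r\<in>{0<..<1}. circle_mean p f r)"
  proof -
    have "0 \<le> circle_mean p f (1/2)" using f p by (intro circle_mean_nonneg) auto
    also have "\<dots> \<le> (SUP r\<in>{0<..<1}. circle_mean p f r)"
      by (rule cSUP_upper) (auto intro!: bdd_aboveI2 le)
    finally show ?thesis .
  qed
  ultimately have "Hardy_norm p f \<le> (K powr p) powr (1 / p)"
    unfolding Hardy_norm_def using p by (intro powr_mono2) auto
  then show ?thesis using p K by (simp add: powr_powr)
qed

text \<open>The single membership criterion used below; it covers multiplication by bounded functions and the
addition of constants.\<close>
lemma Hardy_dominated: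
  assumes f: "f \<in> Hardy p" and g: "g holomorphic_on ball 0 1" and p: "0 < p"
    and le: "\<And>z. z \<in> ball 0 1 \<Longrightarrow> norm (g z) \<le> A + B * norm (f z)"
  shows "g \<in> Hardy p"
proof -
  note hol = Hardy_holomorphic[OF f]
  define C where "C = (2 * \<bar>A\<bar>) powr p"
  define D where "D = (2 * \<bar>B\<bar>) powr p"
  have CD: "C \<ge> 0" "D \<ge> 0" by (auto simp: C_def D_def)
  have pw: "norm (g z) powr p \<le> C + D * norm (f z) powr p" if "z \<in> ball 0 1" for z
  proof -
    have "norm (g z) \<le> \<bar>A\<bar> + \<bar>B\<bar> * norm (f z)"
      by (rule order_trans[OF le[OF that]]) (intro add_mono mult_right_mono, auto)
    also have "\<dots> \<le> max (2 * \<bar>A\<bar>) (2 * \<bar>B\<bar> * norm (f z))" by linarith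
    finally have "norm (g z) powr p \<le> max (2 * \<bar>A\<bar>) (2 * \<bar>B\<bar> * norm (f z)) powr p"
      using p by (intro powr_mono2) auto
    also have "\<dots> \<le> (2 * \<bar>A\<bar>) powr p + (2 * \<bar>B\<bar> * norm (f z)) powr p"
      by (auto simp: max_def)
    also have "\<dots> = C + D * norm (f z) powr p"
      by (simp add: C_def D_def powr_mult)
    finally show ?thesis .
  qed
  obtain K where K: "\<And>r. r \<in> {0<..<1} \<Longrightarrow> circle_mean p f r \<le> K"
    using Hardy_bdd[OF f] unfolding bdd_above_def by blast
  have "circle_mean p g r \<le> C + D * K" if r: "r \<in> {0<..<1}" for r
  proof -
    have cf: "continuous_on S (\<lambda>t. norm (f (of_real r * cis t)) powr p)" for S
      using r p hol by (intro continuous_on_circle_powr) auto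
    have cg: "continuous_on S (\<lambda>t. norm (g (of_real r * cis t)) powr p)" for S
      using r p g by (intro continuous_on_circle_powr) auto
    have "circle_mean p g r \<le> mean (\<lambda>t. C + D * norm (f (of_real r * cis t)) powr p)"
      unfolding circle_mean_eq_mean
    proof (rule mean_mono)
      show "norm (g (of_real r * cis t)) powr p \<le> C + D * norm (f (of_real r * cis t)) powr p" for t
        using r by (intro pw) (auto simp: norm_mult)
    qed (intro continuous_on_add continuous_on_mult continuous_on_const cf cg)+
    also have "\<dots> = C + D * circle_mean p f r"
      unfolding circle_mean_eq_mean
      by (subst mean_add) (auto intro!: continuous_on_mult continuous_on_const cf simp: mean_cmult[OF cf])
    also have "\<dots> \<le> C + D * K"
      using K[OF r] CD by (intro add_left_mono mult_left_mono)
    finally show ?thesis .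
  qed
  then show ?thesis
    using g by (auto simp: Hardy_def intro!: bdd_aboveI2[where M = "C + D * K"])
qed

section \<open>The distance from 1 to the multiples of an inner function\<close>

text \<open>Convexity of \<open>w \<mapsto> |w|\<^sup>p\<close>: the left-hand side is its tangent at \<open>w = 1\<close>.\<close>
lemma powr_tangent_le:
  assumes "1 < p"
  shows "1 + p * Re (w - 1) \<le> norm w powr p"
proof (cases "w = 0")
  case False
  have "(norm w powr p) powr (1 / p) * 1 powr (1 - 1 / p) \<le> 1 / p * norm w powr p + (1 - 1 / p) * 1"
    using assms False by (intro Youngs_inequality_0) auto
  then have "norm w \<le> 1 / p * norm w powr p + (1 - 1 / p)"
    using assms by (simp add: powr_powr)
  then have "p * norm w \<le> p * (1 / p * norm w powr p + (1 - 1 / p))"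
    using assms by (intro mult_left_mono) auto
  also have "\<dots> = norm w powr p + p - 1"
    using assms by (simp add: field_simps)
  finally have "p * norm w \<le> norm w powr p + p - 1" .
  moreover have "p * Re w \<le> p * norm w"
    using assms complex_Re_le_cmod[of w] by (intro mult_left_mono) auto
  ultimately show ?thesis by (simp add: algebra_simps)
qed (use assms in auto)

text \<open>A factor \<open>x\<close> is traded for a constant and a small multiple of \<open>x\<^sup>p\<close>; this lets a bound on
\<open>p\<close>-th means replace uniform integrability.\<close>
lemma le_truncation:
  fixes x L p :: real
  assumes "0 \<le> x" "1 < p" "0 < L"
  shows "x \<le> L + L powr (1 - p) * x powr p"
proof (cases "x \<le> L")
  case False
  then have x: "x > L" "x > 0" using assms by auto
  have "x = x powr (1 - p) * x powr p" using x by (simp flip: powr_add)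
  also have "\<dots> \<le> L powr (1 - p) * x powr p"
    using x assms by (intro mult_right_mono powr_mono2') auto
  finally show ?thesis using assms by linarith
next
  case True
  then show ?thesis by (simp add: add_increasing2)
qed

text \<open>For bounded \<open>f\<close> this is the convergence of the means of \<open>|I|\<^sup>2\<close> to \<open>1\<close>. In general the part of \<open>|f|\<close>
above a level \<open>L\<close> contributes at most \<open>L\<^bsup>1-p\<^esup>\<close> times a bound of the \<open>p\<close>-th means of \<open>f\<close>, because
\<open>0 \<le> 1 - |I|\<^sup>2 \<le> 1\<close>.\<close>
lemma inner_defect_tendsto_0:
  assumes I: "inner_function I" and f: "f \<in> Hardy p" and p: "1 < p"
  shows "((\<lambda>r. mean (\<lambda>t. (1 - norm (I (of_real r * cis t)) ^ 2) * norm (f (of_real r * cis t)))) \<longlongrightarrow> 0) (at_left 1)"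
    (is "((\<lambda>r. ?d r) \<longlongrightarrow> 0) _")
proof (rule tendstoI)
  fix e :: real assume e: "e > 0"
  have hI: "I holomorphic_on ball 0 1" using I by (simp add: inner_function_def)
  note hf = Hardy_holomorphic[OF f]
  obtain K where K: "\<And>r. r \<in> {0<..<1} \<Longrightarrow> circle_mean p f r \<le> K"
    using Hardy_bdd[OF f] unfolding bdd_above_def by blast
  have "((\<lambda>L. L powr (1 - p) * K) \<longlongrightarrow> 0 * K) at_top"
    using p by (intro tendsto_mult tendsto_const tendsto_neg_powr filterlim_ident) auto
  then have "\<forall>\<^sub>F L in at_top. L powr (1 - p) * K < e / 2"
    using e by (intro order_tendstoD(2)) auto
  then obtain L where L: "L > 0" "L powr (1 - p) * K < e / 2"
    using eventually_conj[OF eventually_gt_at_top[of 0]] eventually_happens'[OF trivial_limit_at_top_linorder]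
    by (metis (no_types, lifting))
  have "((\<lambda>r. L * (1 - mean (\<lambda>t. norm (I (of_real r * cis t)) ^ 2))) \<longlongrightarrow> L * (1 - 1)) (at_left 1)"
    by (intro tendsto_intros inner_mean_tendsto I)
  then have "\<forall>\<^sub>F r in at_left 1. L * (1 - mean (\<lambda>t. norm (I (of_real r * cis t)) ^ 2)) < e / 2"
    using e by (intro order_tendstoD(2)) auto
  then show "\<forall>\<^sub>F r in at_left 1. dist (?d r) 0 < e"
    using eventually_at_left_real[of 0 "1 :: real", simplified]
  proof eventually_elim
    case (elim r)
    then have r: "r \<in> {0<..<1}" by auto
    have disc: "of_real r * cis t \<in> ball 0 1" for t using r by (simp add: norm_mult)
    have cI: "continuous_on S (\<lambda>t. I (of_real r * cis t))" for S
      using r by (intro continuous_on_circle holomorphic_on_imp_continuous_on hI) auto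
    have cf: "continuous_on S (\<lambda>t. f (of_real r * cis t))" for S
      using r by (intro continuous_on_circle holomorphic_on_imp_continuous_on hf) auto
    have cfp: "continuous_on S (\<lambda>t. norm (f (of_real r * cis t)) powr p)" for S
      using r p by (intro continuous_on_circle_powr hf) auto
    have cd: "continuous_on S (\<lambda>t. (1 - norm (I (of_real r * cis t)) ^ 2) * norm (f (of_real r * cis t)))" for S
      by (intro continuous_intros cI cf)
    have c1: "continuous_on S (\<lambda>t. 1 - norm (I (of_real r * cis t)) ^ 2)" for S
      by (intro continuous_intros cI)
    have I2: "norm (I (of_real r * cis t)) ^ 2 \<le> 1" for t
      using inner_norm_le_1[OF I disc] by (simp add: power_le_one)
    have "?d r \<le> mean (\<lambda>t. L * (1 - norm (I (of_real r * cis t)) ^ 2)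
                        + L powr (1 - p) * norm (f (of_real r * cis t)) powr p)"
    proof (rule mean_mono[OF cd])
      fix t
      let ?x = "norm (f (of_real r * cis t))" and ?y = "1 - norm (I (of_real r * cis t)) ^ 2"
      have "?y * ?x \<le> ?y * (L + L powr (1 - p) * ?x powr p)"
        using I2[of t] p L by (intro mult_left_mono le_truncation) auto
      also have "\<dots> = L * ?y + ?y * (L powr (1 - p) * ?x powr p)" by (simp add: algebra_simps)
      also have "\<dots> \<le> L * ?y + 1 * (L powr (1 - p) * ?x powr p)"
        by (intro add_left_mono mult_right_mono) auto
      finally show "?y * ?x \<le> L * ?y + L powr (1 - p) * ?x powr p" by simp
    qed (intro continuous_on_add continuous_on_mult continuous_on_const c1 cfp)
    also have "\<dots> = L * mean (\<lambda>t. 1 - norm (I (of_real r * cis t)) ^ 2) + L powr (1 - p) * circle_mean p f r"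
      unfolding circle_mean_eq_mean
      by (subst mean_add) (auto intro!: continuous_on_mult continuous_on_const cfp c1 simp: mean_cmult[OF cfp] mean_cmult[OF c1])
    also have "mean (\<lambda>t. 1 - norm (I (of_real r * cis t)) ^ 2) = 1 - mean (\<lambda>t. norm (I (of_real r * cis t)) ^ 2)"
      using mean_add[of "\<lambda>t. 1 - norm (I (of_real r * cis t)) ^ 2" "\<lambda>t. norm (I (of_real r * cis t)) ^ 2"]
      by (simp add: c1 continuous_on_power continuous_on_norm cI)
    also have "L * (1 - mean (\<lambda>t. norm (I (of_real r * cis t)) ^ 2)) + L powr (1 - p) * circle_mean p f r
        < e / 2 + e / 2"
    proof (rule add_less_le_mono)
      have "L powr (1 - p) * circle_mean p f r \<le> L powr (1 - p) * K"
        by (intro mult_left_mono K r) auto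
      then show "L powr (1 - p) * circle_mean p f r \<le> e / 2" using L by linarith
    qed (use elim in auto)
    finally have "?d r < e" by simp
    moreover have "0 \<le> ?d r"
      using I2 by (intro mean_nonneg cd) auto
    ultimately show ?case by simp
  qed
qed

text \<open>Let \<open>a = cnj (I 0)\<close>. The extremal function is \<open>v \<circ> I\<close> with \<open>v x = (1 - a x)\<^bsup>2/p\<^esup>\<close>: since \<open>v 0 = 1\<close> it
has the form \<open>1 - I G\<close>, and on the boundary circle \<open>|v \<circ> I|\<^sup>p = |1 - a I|\<^sup>2\<close> has mean \<open>1 - |a|\<^sup>2\<close>. An
arbitrary \<open>u = 1 - I G\<close> is compared with it by the tangent inequality
\<open>|u|\<^sup>p \<ge> |v|\<^sup>p (1 + p Re (u / v - 1))\<close>, with \<open>v\<close> short for \<open>v \<circ> I\<close>. The linear term is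
\<open>|1 - a I|\<^sup>2 (u / v - 1) = (1 - cnj a * cnj I) I H = (I - I 0 |I|\<^sup>2) H\<close> with a function \<open>H\<close> of the Hardy
space. Where \<open>|I| = 1\<close> this is \<open>(I - I 0) H\<close>, which is holomorphic and vanishes at \<open>0\<close>, so its mean
is zero.

Everything is done on circles of radius \<open>r < 1\<close>, where \<open>|I| = 1\<close> fails; the resulting error is
controlled by the mean of \<open>(1 - |I|\<^sup>2) |H|\<close> and tends to \<open>0\<close> as \<open>r \<rightarrow> 1\<close>.\<close>
lemma norm_inner_0_lower_bound:
  assumes I: "inner_function I" and G: "G \<in> Hardy p" and p: "1 < p"
    and M: "\<And>r. r \<in> {0<..<1} \<Longrightarrow> circle_mean p (\<lambda>z. 1 - I z * G z) r \<le> M"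
  shows "1 - (norm (I 0))\<^sup>2 \<le> M"
proof (cases "norm (I 0) < 1")
  case False
  note hG = Hardy_holomorphic[OF G]
  have hI: "I holomorphic_on ball 0 1" using I by (simp add: inner_function_def)
  have "0 \<le> circle_mean p (\<lambda>z. 1 - I z * G z) (1/2)"
    using p by (intro circle_mean_nonneg holomorphic_intros hI hG) auto
  also have "\<dots> \<le> M" by (rule M) auto
  finally show ?thesis using False by (smt (verit) one_le_power)
next
  case True
  note hG = Hardy_holomorphic[OF G]
  have hI: "I holomorphic_on ball 0 1" using I by (simp add: inner_function_def)
  define a where "a = cnj (I 0)"
  have a: "norm a < 1" using True by (simp add: a_def)
  \<comment> \<open>An open neighbourhood of the closed disc on which \<open>1 - a x\<close> avoids the branch cut of the power.\<close>
  define S where "S = {x. Re (1 - a * x) > 0}"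
  have S: "open S" unfolding S_def by (intro open_Collect_less continuous_intros)
  have cball_S: "x \<in> S" if "norm x \<le> 1" for x
  proof -
    have "Re (a * x) \<le> norm a * norm x"
      using complex_Re_le_cmod[of "a * x"] by (simp add: norm_mult)
    also have "\<dots> \<le> norm a * 1" using that by (intro mult_left_mono) auto
    finally show ?thesis using a by (simp add: S_def)
  qed
  define v where "v = (\<lambda>x. (1 - a * x) powr of_real (2 / p))"
  have nonpos: "1 - a * x \<notin> \<real>\<^sub>\<le>\<^sub>0" if "x \<in> S" for x
    using that by (auto simp: S_def complex_nonpos_Reals_iff)
  have hv: "v holomorphic_on S"
    unfolding v_def using nonpos by (intro holomorphic_intros) auto
  have v0: "v 0 = 1" by (simp add: v_def)
  have v_nz: "v x \<noteq> 0" if "x \<in> S" for x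
    using nonpos[OF that] by (auto simp: v_def)
  have norm_v: "norm (v x) powr p = (norm (1 - a * x))\<^sup>2" if "x \<in> S" for x
  proof -
    have "1 - a * x \<noteq> 0" using nonpos[OF that] by auto
    then show ?thesis using p by (simp add: v_def norm_powr_real_powr' powr_powr powr_numeral)
  qed
  \<comment> \<open>The holomorphic quotient \<open>(v x - 1) / x\<close>, so that \<open>v \<circ> I - 1\<close> can be divided by \<open>I\<close> even at zeros
    of \<open>I\<close>.\<close>
  define k where "k = (\<lambda>x. if x = 0 then deriv v 0 else (v x - v 0) / (x - 0))"
  have hk: "k holomorphic_on S"
    unfolding k_def by (rule pole_lemma_open[OF hv S])
  have v_eq: "v x = 1 + x * k x" for x by (auto simp: k_def v0)
  define c where "c = (\<lambda>x. (1 - a * x) / v x)"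
  have hc: "c holomorphic_on S"
    unfolding c_def using v_nz by (intro holomorphic_intros hv) auto
  have I_S: "I z \<in> S" if "z \<in> ball 0 1" for z
    using cball_S inner_norm_le_1[OF I that] by auto
  define H where "H = (\<lambda>z. - c (I z) * (G z + k (I z)))"
  have bdd: "\<exists>C. \<forall>x\<in>cball 0 1. norm (\<phi> x) \<le> C" if "\<phi> holomorphic_on S" for \<phi> :: "complex \<Rightarrow> complex"
  proof -
    have "compact (\<phi> ` cball 0 1)"
      using cball_S by (intro compact_continuous_image holomorphic_on_imp_continuous_on
          holomorphic_on_subset[OF that]) auto
    then show ?thesis using compact_imp_bounded by (fastforce simp: bounded_iff)
  qed
  obtain C D where C: "\<And>x. norm x \<le> 1 \<Longrightarrow> norm (c x) \<le> C" and D: "\<And>x. norm x \<le> 1 \<Longrightarrow> norm (k x) \<le> D"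
    using bdd[OF hc] bdd[OF hk] by (auto simp: Ball_def)
  have hH: "H holomorphic_on ball 0 1"
  proof -
    have "(\<lambda>z. c (I z)) holomorphic_on ball 0 1" "(\<lambda>z. k (I z)) holomorphic_on ball 0 1"
      using holomorphic_on_compose_gen[OF hI hc image_subsetI[OF I_S]]
        holomorphic_on_compose_gen[OF hI hk image_subsetI[OF I_S]]
      by (simp_all add: o_def)
    then show ?thesis unfolding H_def by (intro holomorphic_intros hG) auto
  qed
  have H: "H \<in> Hardy p"
  proof (rule Hardy_dominated[OF G hH])
    fix z :: complex assume z: "z \<in> ball 0 1"
    note Iz = inner_norm_le_1[OF I z]
    have "norm (H z) = norm (c (I z)) * norm (G z + k (I z))" by (simp add: H_def norm_mult)
    also have "\<dots> \<le> C * (norm (G z) + D)"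
      using C[OF Iz] D[OF Iz] by (intro mult_mono norm_triangle_le) (auto intro: order_trans[OF norm_ge_zero])
    finally show "norm (H z) \<le> C * D + C * norm (G z)" by (simp add: algebra_simps)
  qed (use p in auto)
  let ?m = "\<lambda>r. mean (\<lambda>t. norm (I (of_real r * cis t)) ^ 2)"
  let ?d = "\<lambda>r. mean (\<lambda>t. (1 - norm (I (of_real r * cis t)) ^ 2) * norm (H (of_real r * cis t)))"
  \<comment> \<open>The holomorphic part of the lower bound for \<open>|u|\<^sup>p\<close>; its mean is its value at \<open>0\<close>.\<close>
  define X where "X = (\<lambda>z. - 2 * a * I z + of_real p * (I z - I 0) * H z)"
  have hX: "X holomorphic_on ball 0 1"
    unfolding X_def by (intro holomorphic_intros hI hH)
  have pw: "1 + (norm a)\<^sup>2 * norm (I z) ^ 2 + Re (X z) + (- p * norm a) * ((1 - norm (I z) ^ 2) * norm (H z))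
        \<le> norm (1 - I z * G z) powr p" if z: "z \<in> ball 0 1" for z
  proof -
    define x where "x = I z"
    have x: "norm x \<le> 1" "x \<in> S" using inner_norm_le_1[OF I z] I_S[OF z] by (auto simp: x_def)
    define w where "w = (1 - x * G z) / v x"
    have vx: "v x \<noteq> 0" using v_nz x by simp
    have wH: "(1 - a * x) * (w - 1) = x * H z"
    proof -
      have "w - 1 = - (x * (G z + k x)) / v x"
        using vx v_eq[of x] by (simp add: w_def field_simps)
      then show ?thesis by (simp add: H_def c_def x_def[symmetric])
    qed
    have sq: "of_real ((norm (1 - a * x))\<^sup>2) = (1 - cnj a * cnj x) * (1 - a * x)"
      unfolding complex_norm_square by (simp add: mult.commute)
    have xx: "x * cnj x = of_real ((norm x)\<^sup>2)" unfolding complex_norm_square ..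
    have "of_real ((norm (1 - a * x))\<^sup>2) * (w - 1) = (1 - cnj a * cnj x) * (x * H z)"
      unfolding sq mult.assoc wH ..
    also have "\<dots> = x * H z - cnj a * (x * cnj x) * H z"
      by (simp add: algebra_simps)
    also have "\<dots> = (x - cnj a) * H z + of_real (1 - (norm x)\<^sup>2) * (cnj a * H z)"
      unfolding xx by (simp add: algebra_simps)
    finally have eq: "of_real ((norm (1 - a * x))\<^sup>2) * (w - 1)
        = (x - cnj a) * H z + of_real (1 - (norm x)\<^sup>2) * (cnj a * H z)" .
    have "(norm (1 - a * x))\<^sup>2 * Re (w - 1) = Re (of_real ((norm (1 - a * x))\<^sup>2) * (w - 1))"
      by (simp only: Re_complex_of_real Im_complex_of_real times_complex.simps)
    also have "\<dots> = Re ((x - cnj a) * H z) + (1 - (norm x)\<^sup>2) * Re (cnj a * H z)"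
      unfolding eq plus_complex.simps by (simp only: times_complex.simps Re_complex_of_real Im_complex_of_real)
    finally have re: "(norm (1 - a * x))\<^sup>2 * Re (w - 1) = Re ((x - cnj a) * H z) + (1 - (norm x)\<^sup>2) * Re (cnj a * H z)" .
    have x1: "0 \<le> 1 - (norm x)\<^sup>2" using x by (simp add: power_le_one)
    have "- (norm a * norm (H z)) \<le> Re (cnj a * H z)"
      using abs_Re_le_cmod[of "cnj a * H z"] by (simp add: norm_mult)
    then have low: "(1 - (norm x)\<^sup>2) * - (norm a * norm (H z)) \<le> (1 - (norm x)\<^sup>2) * Re (cnj a * H z)"
      by (intro mult_left_mono x1)
    have "(norm (1 - a * x))\<^sup>2 * (1 + p * Re (w - 1)) \<le> (norm (1 - a * x))\<^sup>2 * norm w powr p"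
      by (intro mult_left_mono powr_tangent_le p) auto
    also have "\<dots> = norm (1 - x * G z) powr p"
      unfolding norm_v[OF x(2), symmetric] using vx
      by (simp add: w_def norm_divide flip: powr_mult)
    finally have main: "(norm (1 - a * x))\<^sup>2 + p * ((norm (1 - a * x))\<^sup>2 * Re (w - 1)) \<le> norm (1 - x * G z) powr p"
      by (simp add: algebra_simps)
    have expand: "(norm (1 - a * x))\<^sup>2 = 1 + (norm a)\<^sup>2 * (norm x)\<^sup>2 - 2 * Re (a * x)"
      unfolding cmod_power2 by (simp add: power2_eq_square algebra_simps)
    have "p * ((1 - (norm x)\<^sup>2) * - (norm a * norm (H z))) \<le> p * ((1 - (norm x)\<^sup>2) * Re (cnj a * H z))"
      using p by (intro mult_left_mono low) auto
    moreover have "Re (X z) = - 2 * Re (a * x) + p * Re ((x - cnj a) * H z)"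
      by (simp add: X_def x_def a_def algebra_simps)
    moreover have "(- p * norm a) * ((1 - (norm x)\<^sup>2) * norm (H z)) = p * ((1 - (norm x)\<^sup>2) * - (norm a * norm (H z)))"
      by simp
    moreover note main[unfolded re distrib_left] expand
    ultimately show ?thesis
      unfolding x_def[symmetric] by linarith
  qed
  have "1 + (norm a)\<^sup>2 * ?m r - 2 * (norm a)\<^sup>2 + (- p * norm a) * ?d r \<le> M" if r: "r \<in> {0<..<1}" for r
  proof -
    have disc: "of_real r * cis t \<in> ball 0 1" for t using r by (simp add: norm_mult)
    have cont: "continuous_on T (\<lambda>t. \<phi> (of_real r * cis t))" if "\<phi> holomorphic_on ball 0 1" for \<phi> T
      using r that by (intro continuous_on_circle holomorphic_on_imp_continuous_on) auto
    note cI = cont[OF hI] and cH = cont[OF hH] and cX = cont[OF hX]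
    have c1: "continuous_on T (\<lambda>t. norm (I (of_real r * cis t)) ^ 2)" for T
      by (intro continuous_intros cI)
    have c2: "continuous_on T (\<lambda>t. (1 - norm (I (of_real r * cis t)) ^ 2) * norm (H (of_real r * cis t)))" for T
      by (intro continuous_intros cI cH)
    have c3: "continuous_on T (\<lambda>t. Re (X (of_real r * cis t)))" for T
      by (intro continuous_intros cX)
    have "X 0 = of_real (- 2 * (norm a)\<^sup>2)"
      unfolding of_real_mult complex_norm_square by (simp add: X_def a_def)
    then have X0: "mean (\<lambda>t. Re (X (of_real r * cis t))) = - 2 * (norm a)\<^sup>2"
      using mean_linear[OF bounded_linear_Re cX] mean_holomorphic[OF hX, of r] r by simp
    have "1 + (norm a)\<^sup>2 * ?m r - 2 * (norm a)\<^sup>2 + (- p * norm a) * ?d r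
        = mean (\<lambda>t. 1) + mean (\<lambda>t. (norm a)\<^sup>2 * norm (I (of_real r * cis t)) ^ 2)
          + mean (\<lambda>t. Re (X (of_real r * cis t)))
          + mean (\<lambda>t. (- p * norm a) * ((1 - norm (I (of_real r * cis t)) ^ 2) * norm (H (of_real r * cis t))))"
      unfolding X0 mean_cmult[OF c1] mean_cmult[OF c2] by simp
    also have "\<dots> = mean (\<lambda>t. 1 + (norm a)\<^sup>2 * norm (I (of_real r * cis t)) ^ 2 + Re (X (of_real r * cis t))
          + (- p * norm a) * ((1 - norm (I (of_real r * cis t)) ^ 2) * norm (H (of_real r * cis t))))"
      by (subst mean_add, (intro continuous_on_add continuous_on_mult continuous_on_const c1 c2 c3)+)+ (rule refl)
    also have "\<dots> \<le> circle_mean p (\<lambda>z. 1 - I z * G z) r"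
      unfolding circle_mean_eq_mean
    proof (rule mean_mono)
      show "continuous_on {0..2 * pi} (\<lambda>t. norm (1 - I (of_real r * cis t) * G (of_real r * cis t)) powr p)"
        using r p by (intro continuous_on_circle_powr[where f = "\<lambda>z. 1 - I z * G z"] holomorphic_intros hI hG) auto
    qed (intro continuous_on_add continuous_on_mult continuous_on_const c1 c2 c3 pw disc)+
    also have "\<dots> \<le> M" by (rule M[OF r])
    finally show ?thesis .
  qed
  then have "\<forall>\<^sub>F r in at_left 1. 1 + (norm a)\<^sup>2 * ?m r - 2 * (norm a)\<^sup>2 + (- p * norm a) * ?d r \<le> M"
    using eventually_at_left_real[of 0 1] by (auto elim: eventually_mono)
  moreover have "((\<lambda>r. 1 + (norm a)\<^sup>2 * ?m r - 2 * (norm a)\<^sup>2 + (- p * norm a) * ?d r)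
      \<longlongrightarrow> 1 + (norm a)\<^sup>2 * 1 - 2 * (norm a)\<^sup>2 + (- p * norm a) * 0) (at_left 1)"
    by (intro tendsto_add tendsto_diff tendsto_mult tendsto_const inner_mean_tendsto I
        inner_defect_tendsto_0[OF I H p])
  ultimately have "1 + (norm a)\<^sup>2 * 1 - 2 * (norm a)\<^sup>2 + (- p * norm a) * 0 \<le> M"
    by (intro tendsto_upperbound) auto
  then show ?thesis by (simp add: a_def)
qed

section \<open>The error of an optimal approximant\<close>

lemma Hardy_norm_smooth:
  assumes p: "2 < p" and h: "h \<in> Hardy p" and h0: "h 0 = 0"
  shows "(Hardy_norm p (\<lambda>z. a + h z))\<^sup>2 \<le> (norm a)\<^sup>2 + (p - 1) * (Hardy_norm p h)\<^sup>2"
proof -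
  note hol = Hardy_holomorphic[OF h]
  define B where "B = (norm a)\<^sup>2 + (p - 1) * (Hardy_norm p h)\<^sup>2"
  have B: "B \<ge> 0" unfolding B_def using p by (intro add_nonneg_nonneg mult_nonneg_nonneg) auto
  have "Hardy_norm p (\<lambda>z. a + h z) \<le> sqrt B"
  proof (rule Hardy_norm_le)
    fix r :: real assume r: "r \<in> {0<..<1}"
    let ?M = "circle_mean p (\<lambda>z. a + h z) r"
    have M: "?M \<ge> 0" using r p by (intro circle_mean_nonneg holomorphic_intros hol) auto
    have Mh: "circle_mean p h r \<ge> 0" using r p by (intro circle_mean_nonneg hol) auto
    have "?M powr (2 / p) \<le> (norm a)\<^sup>2 + (p - 1) * circle_mean p h r powr (2 / p)"
      unfolding circle_mean_eq_mean
    proof (rule mean_norm_powr_smooth[OF p])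
      show "continuous_on {0..2 * pi} (\<lambda>t. h (of_real r * cis t))"
        using r by (intro continuous_on_circle holomorphic_on_imp_continuous_on hol) auto
      show "mean (\<lambda>t. h (of_real r * cis t)) = 0"
        using mean_holomorphic[OF hol] r h0 by simp
    qed
    also have "circle_mean p h r powr (2 / p) \<le> (Hardy_norm p h powr p) powr (2 / p)"
      using p circle_mean_le_Hardy_norm[OF h _ r] Mh by (intro powr_mono2) auto
    also have "(Hardy_norm p h powr p) powr (2 / p) = (Hardy_norm p h)\<^sup>2"
      using p Hardy_norm_nonneg[of p h] by (simp add: powr_powr)
    finally have "?M powr (2 / p) \<le> B" using p by (simp add: B_def)
    then have "(?M powr (2 / p)) powr (p / 2) \<le> B powr (p / 2)"
      using p by (intro powr_mono2) auto
    also have "B powr (p / 2) = sqrt B powr p"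
      using B by (simp add: powr_half_sqrt[symmetric] powr_powr)
    finally show "?M \<le> sqrt B powr p" using p M by (simp add: powr_powr)
  qed (use p B in \<open>auto intro!: holomorphic_intros hol\<close>)
  then have "(Hardy_norm p (\<lambda>z. a + h z))\<^sup>2 \<le> (sqrt B)\<^sup>2"
    by (intro power_mono Hardy_norm_nonneg)
  then show ?thesis using B by (simp add: B_def)
qed

lemma Hardy_norm_cmult_le:
  assumes p: "0 < p" and h: "h \<in> Hardy p"
  shows "Hardy_norm p (\<lambda>z. c * h z) \<le> norm c * Hardy_norm p h"
proof (rule Hardy_norm_le)
  note hol = Hardy_holomorphic[OF h]
  fix r :: real assume r: "r \<in> {0<..<1}"
  have "circle_mean p (\<lambda>z. c * h z) r = norm c powr p * circle_mean p h r"
    unfolding circle_mean_eq_mean norm_mult powr_mult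
    using r p by (intro mean_cmult continuous_on_circle_powr hol) auto
  also have "\<dots> \<le> norm c powr p * Hardy_norm p h powr p"
    by (intro mult_left_mono circle_mean_le_Hardy_norm h p r) auto
  finally show "circle_mean p (\<lambda>z. c * h z) r \<le> (norm c * Hardy_norm p h) powr p"
    by (simp add: powr_mult Hardy_norm_nonneg)
qed (use p in \<open>auto intro!: holomorphic_intros Hardy_holomorphic[OF h] mult_nonneg_nonneg Hardy_norm_nonneg\<close>)

text \<open>The competitor is a constant polynomial \<open>c\<close>. By smoothness its squared error is at most
\<open>|1 - c f 0|\<^sup>2 + |c|\<^sup>2 B\<close> with \<open>B = (p - 1) \<parallel>f - f 0\<parallel>\<^sup>2\<close>, and this quadratic in \<open>c\<close> is minimal, with value
\<open>B / (|f 0|\<^sup>2 + B)\<close>, at \<open>c = cnj (f 0) / (|f 0|\<^sup>2 + B)\<close>.\<close>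
lemma optimal_approximant_error:
  assumes p: "2 < p" and f: "f \<in> Hardy p" and f0: "f 0 \<noteq> 0" and q: "optimal_approximant p n f q"
  defines "N \<equiv> Hardy_norm p (\<lambda>z. f z - f 0)"
  shows "(Hardy_norm p (\<lambda>z. 1 - poly q z * f z))\<^sup>2
    \<le> (p - 1) * N\<^sup>2 / ((norm (f 0))\<^sup>2 + (p - 1) * N\<^sup>2)"
proof -
  define A where "A = (norm (f 0))\<^sup>2"
  define B where "B = (p - 1) * N\<^sup>2"
  have A: "A > 0" using f0 by (simp add: A_def)
  have B: "B \<ge> 0" unfolding B_def using p by simp
  define c where "c = cnj (f 0) / of_real (A + B)"
  define h where "h = (\<lambda>z. f z - f 0)"
  have h: "h \<in> Hardy p"
    unfolding h_def
  proof (rule Hardy_dominated[OF f, where A = "norm (f 0)" and B = 1])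
    show "norm (f z - f 0) \<le> norm (f 0) + 1 * norm (f z)" for z
      using norm_triangle_ineq4[of "f z" "f 0"] by simp
  qed (use p in \<open>auto intro!: holomorphic_intros Hardy_holomorphic[OF f]\<close>)
  have ch: "(\<lambda>z. - c * h z) \<in> Hardy p"
    by (rule Hardy_dominated[OF h, where A = 0 and B = "norm c"])
       (use p in \<open>auto intro!: holomorphic_intros Hardy_holomorphic[OF h] simp: norm_mult\<close>)
  have "Hardy_norm p (\<lambda>z. 1 - poly q z * f z) = (INF r\<in>{r. degree r \<le> n}. Hardy_norm p (\<lambda>z. 1 - poly r z * f z))"
    using q by (simp add: optimal_approximant_def)
  also have "\<dots> \<le> Hardy_norm p (\<lambda>z. 1 - poly [:c:] z * f z)"
    by (rule cINF_lower) (auto intro!: bdd_belowI2[where m = 0] Hardy_norm_nonneg)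
  also have "(\<lambda>z. 1 - poly [:c:] z * f z) = (\<lambda>z. (1 - c * f 0) + - c * h z)"
    by (auto simp: h_def algebra_simps)
  finally have "(Hardy_norm p (\<lambda>z. 1 - poly q z * f z))\<^sup>2 \<le> (Hardy_norm p (\<lambda>z. (1 - c * f 0) + - c * h z))\<^sup>2"
    by (intro power_mono Hardy_norm_nonneg)
  also have "\<dots> \<le> (norm (1 - c * f 0))\<^sup>2 + (p - 1) * (Hardy_norm p (\<lambda>z. - c * h z))\<^sup>2"
    by (rule Hardy_norm_smooth[OF p ch]) (simp add: h_def)
  also have "\<dots> \<le> (norm (1 - c * f 0))\<^sup>2 + (p - 1) * (norm (- c) * Hardy_norm p h)\<^sup>2"
    using p by (intro add_left_mono mult_left_mono power_mono Hardy_norm_cmult_le h Hardy_norm_nonneg) auto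
  also have "\<dots> = (B / (A + B))\<^sup>2 + A / (A + B)\<^sup>2 * B"
  proof -
    have "cnj (f 0) * f 0 = of_real A"
      unfolding A_def complex_norm_square by (rule mult.commute)
    then have "1 - c * f 0 = of_real (B / (A + B))"
      using A B by (simp add: c_def field_simps flip: of_real_add)
    then have "norm (1 - c * f 0) = B / (A + B)"
      using A B by (simp only: norm_of_real) simp
    moreover have "(norm (- c))\<^sup>2 = A / (A + B)\<^sup>2"
      using A B by (simp add: c_def norm_divide power_divide A_def flip: of_real_add)
    moreover have "(p - 1) * (norm (- c) * Hardy_norm p h)\<^sup>2 = (norm (- c))\<^sup>2 * B"
      unfolding B_def N_def h_def by (simp add: power_mult_distrib)
    ultimately show ?thesis by simp
  qed
  also have "\<dots> = (B * (A + B)) / ((A + B) * (A + B))"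
    by (simp add: power2_eq_square add_divide_distrib distrib_left mult_ac)
  also have "\<dots> = B / (A + B)" using A B by simp
  finally show ?thesis by (simp add: A_def B_def)
qed

lemma outer_function_nonzero: "outer_function F \<Longrightarrow> z \<in> ball 0 1 \<Longrightarrow> F z \<noteq> 0"
  by (force simp: outer_function_def)

section \<open>The roots of an optimal approximant in the disc\<close>

theorem proposition4p11:
  fixes p :: real and n :: nat and f J :: "complex \<Rightarrow> complex" and q :: "complex poly"
  assumes "2 < p"
    and "f \<in> Hardy p"
    and "inner_part p f J"
    and "J 0 \<noteq> 0"
    and "optimal_approximant p n f q"
  shows "norm (\<Prod>w\<in>#{#w \<in># proots q. w \<in> ball 0 1#}. w) \<ge>
    1 / norm (J 0) *
      sqrt (1 - ((p - 1) * (Hardy_norm p (\<lambda>z. f z - f 0))\<^sup>2 /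
        ((norm (f 0))\<^sup>2 + (p - 1) * (Hardy_norm p (\<lambda>z. f z - f 0))\<^sup>2)) powr (p / 2))"
proof -
  have p: "0 < p" "1 < p" using assms(1) by auto
  obtain F where F: "F \<in> Hardy p" "outer_function F" and JF: "\<And>z. z \<in> ball 0 1 \<Longrightarrow> f z = J z * F z"
    and J: "inner_function J"
    using assms(3) by (auto simp: inner_part_def)
  have f0: "f 0 \<noteq> 0" using JF[of 0] outer_function_nonzero[OF F(2), of 0] assms(4) by simp
  define X where "X = (p - 1) * (Hardy_norm p (\<lambda>z. f z - f 0))\<^sup>2 /
        ((norm (f 0))\<^sup>2 + (p - 1) * (Hardy_norm p (\<lambda>z. f z - f 0))\<^sup>2)"
  define A where "A = {#w \<in># proots q. w \<in> ball 0 1#}"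
  define B where "B = (\<lambda>z. \<Prod>w\<in>#A. Moebius_function 0 w z)"
  obtain P where P: "\<And>z. z \<in> ball 0 1 \<Longrightarrow> poly q z = B z * poly P z"
    using poly_disc_roots_factor[of q] unfolding A_def B_def by blast
  have I: "inner_function (\<lambda>z. J z * B z)"
    unfolding B_def by (intro inner_function_mult J inner_function_Blaschke) (auto simp: A_def)
  have poly_bdd: "\<exists>C. \<forall>z\<in>ball 0 1. norm (poly r z) \<le> C" for r :: "complex poly"
  proof -
    have "compact (poly r ` cball 0 1)"
      by (intro compact_continuous_image continuous_intros) auto
    then show ?thesis using compact_imp_bounded by (fastforce simp: bounded_iff)
  qed
  obtain C where C: "\<And>z. z \<in> ball 0 1 \<Longrightarrow> norm (poly P z) \<le> C" using poly_bdd[of P] by blast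
  have G: "(\<lambda>z. poly P z * F z) \<in> Hardy p"
  proof (rule Hardy_dominated[OF F(1), where A = 0 and B = C])
    show "norm (poly P z * F z) \<le> 0 + C * norm (F z)" if "z \<in> ball 0 1" for z
      using C[OF that] by (simp add: norm_mult mult_right_mono)
  qed (use p in \<open>auto intro!: holomorphic_intros Hardy_holomorphic[OF F(1)]\<close>)
  obtain D where D: "\<And>z. z \<in> ball 0 1 \<Longrightarrow> norm (poly q z) \<le> D" using poly_bdd[of q] by blast
  have u: "(\<lambda>z. 1 - poly q z * f z) \<in> Hardy p"
  proof (rule Hardy_dominated[OF assms(2), where A = 1 and B = D])
    show "norm (1 - poly q z * f z) \<le> 1 + D * norm (f z)" if "z \<in> ball 0 1" for z
      using norm_triangle_ineq4[of 1 "poly q z * f z"] mult_right_mono[OF D[OF that] norm_ge_zero[of "f z"]]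
      by (simp add: norm_mult)
  qed (use p in \<open>auto intro!: holomorphic_intros Hardy_holomorphic[OF assms(2)]\<close>)
  let ?e = "Hardy_norm p (\<lambda>z. 1 - poly q z * f z)"
  have "1 - (norm (J 0 * B 0))\<^sup>2 \<le> ?e powr p"
  proof (rule norm_inner_0_lower_bound[OF I G p(2)])
    fix r :: real assume r: "r \<in> {0<..<1}"
    have "circle_mean p (\<lambda>z. 1 - J z * B z * (poly P z * F z)) r = circle_mean p (\<lambda>z. 1 - poly q z * f z) r"
      unfolding circle_mean_eq_mean
    proof (rule mean_cong)
      fix t
      have "of_real r * cis t \<in> ball 0 1" using r by (simp add: norm_mult)
      from P[OF this] JF[OF this]
      show "norm (1 - J (of_real r * cis t) * B (of_real r * cis t) * (poly P (of_real r * cis t) * F (of_real r * cis t))) powr p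
          = norm (1 - poly q (of_real r * cis t) * f (of_real r * cis t)) powr p"
        by (simp add: mult_ac)
    qed
    also have "\<dots> \<le> ?e powr p"
      by (rule circle_mean_le_Hardy_norm[OF u p(1) r])
    finally show "circle_mean p (\<lambda>z. 1 - J z * B z * (poly P z * F z)) r \<le> ?e powr p" .
  qed
  also have "?e powr p = (?e\<^sup>2) powr (p / 2)"
    using Hardy_norm_nonneg[of p "\<lambda>z. 1 - poly q z * f z"] by (simp add: powr_powr flip: powr_numeral)
  also have "\<dots> \<le> X powr (p / 2)"
    unfolding X_def using p by (intro powr_mono2 optimal_approximant_error[OF assms(1,2) f0 assms(5)]) auto
  finally have "1 - X powr (p / 2) \<le> (norm (J 0 * B 0))\<^sup>2" by simp
  then have "sqrt (1 - X powr (p / 2)) \<le> norm (J 0 * B 0)"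
    by (rule real_le_lsqrt[rotated]) simp
  also have "\<dots> = norm (J 0) * norm (\<Prod>w\<in>#A. w)"
    unfolding B_def norm_mult norm_Blaschke_0 ..
  finally show ?thesis
    using assms(4) unfolding X_def[symmetric] A_def[symmetric] by (simp add: field_simps)
qed

end
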